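(* Let $N,d\ge1$ be integers, and let $\mathbf{A}=\xi(\Lambda,Q_N,\dots,Q_0)$ and $\mathbf{B}=\xi(\tilde\Lambda,\tilde Q_N,\dots,\tilde Q_0)$ be two points of the balanced manifold $\mathcal{M}$, where $\Lambda,\tilde\Lambda$ are diagonal $d\times d$ matrices with positive diagonal entries and $Q_p,\tilde Q_p\in O_d$ for $0\le p\le N$. Define $R_p=\tilde Q_p^TQ_p\in O_d$ for $0\le p\le N$, and let $\mathbf{W}(t)=(1-t)\mathbf{A}+t\mathbf{B}$. (1) $\mathbf{W}(t)$ is balanced for all $t\in[0,1]$ if and only if the matrix $$(R_{p+1}-R_{p-1})\left(\tilde\Lambda^{-1}R_p\Lambda\right)^T$$ is skew symmetric for all $1\le p\le N-1$. (2) If $R_p=R_{p-1}$ for all $1\le p\le N$, then $\mathbf{W}(t)\in\mathcal{M}$ for all $t\in[0,1]$.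
   Context: $\mathbb{M}_d$ and $O_d$ denote the sets of all and orthogonal real $d\times d$ matrices, respectively. An $N$-tuple $\mathbf{W}=(W_N,\dots,W_1)\in\mathbb{M}_d^N$ is called balanced if $W_{p+1}^TW_{p+1}=W_pW_p^T$ for all $1\le p\le N-1$. The balanced manifold $\mathcal{M}\subset\mathbb{M}_d^N$ is the set of balanced $N$-tuples all of whose coordinates $W_p$ have rank $d$. The map $\xi$ sends $(\Lambda,Q_N,Q_{N-1},\dots,Q_0)$, with $\Lambda$ a diagonal matrix with positive diagonal entries and $Q_0,\dots,Q_N\in O_d$, to $(W_N,\dots,W_1)$ where $W_p=Q_p\Lambda Q_{p-1}^T$ for $1\le p\le N$. *)

theory Defs
  imports "HOL-Analysis.Analysis"
begin

text \<open>
  The matrix size $d \ge 1$ is \<open>CARD('d)\<close>.  A tuple $(W_N,\dots,W_1)$ of $d \times d$ matrices is a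
  function on \<open>{1..N}\<close>, extended by \<open>undefined\<close>, so that $W_p$ is \<open>W p\<close> and equality of tuples is
  equality of functions.
\<close>

definition matrix_tuples :: "nat \<Rightarrow> (nat \<Rightarrow> real^'d^'d) set" where
  "matrix_tuples N = {1..N} \<rightarrow>\<^sub>E UNIV"

definition balanced :: "nat \<Rightarrow> (nat \<Rightarrow> real^'d^'d) \<Rightarrow> bool" where
  "balanced N W \<longleftrightarrow>
    (\<forall>p\<in>{1..N - 1}. transpose (W (p + 1)) ** W (p + 1) = W p ** transpose (W p))"

definition balanced_manifold :: "nat \<Rightarrow> (nat \<Rightarrow> real^'d^'d) set" where
  "balanced_manifold N =
    {W \<in> matrix_tuples N. balanced N W \<and> (\<forall>p\<in>{1..N}. rank (W p) = CARD('d))}"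

definition positive_diagonal :: "real^'d^'d \<Rightarrow> bool" where
  "positive_diagonal L \<longleftrightarrow> (\<forall>i j. i \<noteq> j \<longrightarrow> L $ i $ j = 0) \<and> (\<forall>i. L $ i $ i > 0)"

definition skew_symmetric :: "real^'d^'d \<Rightarrow> bool" where
  "skew_symmetric X \<longleftrightarrow> transpose X = - X"

definition xi :: "nat \<Rightarrow> real^'d^'d \<Rightarrow> (nat \<Rightarrow> real^'d^'d) \<Rightarrow> nat \<Rightarrow> real^'d^'d" where
  "xi N L Q = (\<lambda>p\<in>{1..N}. Q p ** L ** transpose (Q (p - 1)))"

text \<open>The point $(1-t)A + tB$ of the line through two tuples; function spaces carry no
  \<open>real_vector\<close> structure in the library.\<close>

definition tuple_line ::
    "nat \<Rightarrow> (nat \<Rightarrow> real^'d^'d) \<Rightarrow> (nat \<Rightarrow> real^'d^'d) \<Rightarrow> real \<Rightarrow> nat \<Rightarrow> real^'d^'d" where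
  "tuple_line N A B t = (\<lambda>p\<in>{1..N}. (1 - t) *\<^sub>R A p + t *\<^sub>R B p)"

lemma positive_diagonal_transpose:
  assumes "positive_diagonal L"
  shows "transpose L = L"
proof -
  have "L $ j $ i = L $ i $ j" for i j
    using assms by (cases "i = j") (auto simp: positive_diagonal_def)
  then show ?thesis by (simp add: vec_eq_iff transpose_def)
qed

lemma positive_diagonal_invertible:
  fixes L :: "real^'d^'d"
  assumes "positive_diagonal L"
  shows "invertible L"
proof -
  have "det L = (\<Prod>i\<in>UNIV. L $ i $ i)"
    using assms by (intro det_diagonal) (auto simp: positive_diagonal_def)
  also have "\<dots> > 0"
    using assms by (intro prod_pos) (auto simp: positive_diagonal_def)
  finally show ?thesis by (simp add: invertible_det_nz)
qed

text \<open>The map \<open>xi\<close> takes its values in the balanced manifold, so the membership hypotheses of the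
  theorem on its two endpoints are automatic.\<close>

lemma xi_in_balanced_manifold:
  fixes L :: "real^'d^'d"
  assumes L: "positive_diagonal L"
    and Q: "\<And>p. p \<le> N \<Longrightarrow> orthogonal_matrix (Q p)"
  shows "xi N L Q \<in> balanced_manifold N"
proof -
  have T: "transpose L = L" using L by (rule positive_diagonal_transpose)
  have QQ: "transpose (Q p) ** Q p = mat 1" "Q p ** transpose (Q p) = mat 1" if "p \<le> N" for p
    using Q[OF that] by (auto simp: orthogonal_matrix_def)
  have QQ': "X ** transpose (Q p) ** Q p = X" if "p \<le> N" for p and X :: "real^'d^'d"
    by (metis QQ(1) that matrix_mul_assoc matrix_mul_rid)
  have bal: "balanced N (xi N L Q)"
    by (auto simp: balanced_def xi_def matrix_transpose_mul T matrix_mul_assoc QQ')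
  have rk: "rank (xi N L Q p) = CARD('d)" if "p \<in> {1..N}" for p
  proof -
    have "invertible (Q p)" "invertible (transpose (Q (p - 1)))"
      using that QQ[of p] QQ[of "p - 1"] unfolding invertible_def
      by (auto intro: exI[of _ "transpose (Q p)"] exI[of _ "Q (p - 1)"])
    then have "invertible (xi N L Q p)"
      using that positive_diagonal_invertible[OF L] by (simp add: xi_def invertible_mult)
    then have "inj ((*v) (xi N L Q p))" by (rule inj_matrix_vector_mult)
    then show ?thesis by (simp add: full_rank_injective)
  qed
  have "xi N L Q \<in> matrix_tuples N" by (simp add: matrix_tuples_def xi_def)
  with bal rk show ?thesis by (simp add: balanced_manifold_def)
qed

end

theory Submission
  imports Defs
begin

text \<open>
  The balance defect of a point of the line is quadratic in \<open>t\<close> and vanishes at both endpoints, so it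
  is \<open>t (1 - t)\<close> times the symmetrization of a cross term.  The cross term is congruent to the transpose of the
  matrix in the statement, and congruence preserves skew symmetry.  If all \<open>R p\<close> agree, then
  \<open>A p\<close> and \<open>B p\<close> have polar decompositions with the same orthogonal factor
  \<open>Q p ** transpose (Q (p - 1))\<close>; a convex combination of the positive definite factors is positive
  definite, hence invertible.
\<close>

section \<open>Matrix arithmetic and skew symmetry\<close>

lemma transpose_add: "transpose (X + Y) = transpose X + transpose Y"
  for X Y :: "'a::plus^'n^'m"
  by (simp add: vec_eq_iff transpose_def)

lemma transpose_diff: "transpose (X - Y) = transpose X - transpose Y"
  for X Y :: "'a::minus^'n^'m"
  by (simp add: vec_eq_iff transpose_def)

lemma transpose_uminus: "transpose (- X) = - transpose X"
  for X :: "'a::uminus^'n^'m"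
  by (simp add: vec_eq_iff transpose_def)

lemma matrix_add_rdistrib: "(X + Y) ** Z = X ** Z + Y ** Z"
  for X Y :: "'a::semiring_1^'n^'m" and Z :: "'a^'k^'n"
  by (simp add: vec_eq_iff matrix_matrix_mult_def sum.distrib algebra_simps)

lemma matrix_diff_ldistrib: "X ** (Y - Z) = X ** Y - X ** Z"
  for X :: "'a::ring_1^'n^'m" and Y Z :: "'a^'k^'n"
  by (simp add: vec_eq_iff matrix_matrix_mult_def sum_subtractf algebra_simps)

lemma matrix_diff_rdistrib: "(X - Y) ** Z = X ** Z - Y ** Z"
  for X Y :: "'a::ring_1^'n^'m" and Z :: "'a^'k^'n"
  by (simp add: vec_eq_iff matrix_matrix_mult_def sum_subtractf algebra_simps)

lemma matrix_uminus_left: "(- X) ** Y = - (X ** Y)"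
  for X :: "'a::ring_1^'n^'m" and Y :: "'a^'k^'n"
  by (simp add: vec_eq_iff matrix_matrix_mult_def sum_negf)

lemma matrix_uminus_right: "X ** (- Y) = - (X ** Y)"
  for X :: "'a::ring_1^'n^'m" and Y :: "'a^'k^'n"
  by (simp add: vec_eq_iff matrix_matrix_mult_def sum_negf)

text \<open>Congruence by an arbitrary matrix carries skew symmetric matrices to skew symmetric
  ones. Invertibility gives the converse, because congruence by an inverse of \<open>P\<close>
  undoes congruence by \<open>P\<close>.\<close>

lemma skew_symmetric_congruence:
  fixes P X :: "real^'d^'d"
  assumes "invertible P"
  shows "skew_symmetric (P ** X ** transpose P) \<longleftrightarrow> skew_symmetric X"
proof -
  have *: "skew_symmetric (C ** Y ** transpose C)" if "skew_symmetric Y" for C Y :: "real^'d^'d"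
    using that
    by (simp add: skew_symmetric_def matrix_transpose_mul matrix_uminus_left matrix_uminus_right
        flip: matrix_mul_assoc)
  obtain P' where P': "P' ** P = mat 1"
    using assms by (auto simp: invertible_def)
  have "P' ** (P ** X ** transpose P) ** transpose P' = (P' ** P) ** X ** transpose (P' ** P)"
    by (simp add: matrix_transpose_mul matrix_mul_assoc)
  also have "\<dots> = X"
    by (simp add: P')
  finally show ?thesis
    using *[of X P] *[of "P ** X ** transpose P" P'] by auto
qed

lemma skew_symmetric_transpose: "skew_symmetric (transpose X) \<longleftrightarrow> skew_symmetric X"
  unfolding skew_symmetric_def by (metis transpose_transpose transpose_uminus)

section \<open>The balance defect along the line\<close>

text \<open>Expand both products bilinearly. The terms with coefficients (1 - t)^2 and t^2 are the
  defects of the two endpoints and cancel by \<open>A\<close> and \<open>B\<close>. The mixed terms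
  share the coefficient t (1 - t) and pair up into \<open>S\<close> and its transpose.\<close>

lemma balance_defect_line:
  fixes A\<^sub>1 B\<^sub>1 A\<^sub>2 B\<^sub>2 :: "real^'d^'d" and t :: real
  assumes A: "transpose A\<^sub>2 ** A\<^sub>2 = A\<^sub>1 ** transpose A\<^sub>1"
    and B: "transpose B\<^sub>2 ** B\<^sub>2 = B\<^sub>1 ** transpose B\<^sub>1"
  defines "S \<equiv> transpose A\<^sub>2 ** B\<^sub>2 - A\<^sub>1 ** transpose B\<^sub>1"
  shows "transpose ((1 - t) *\<^sub>R A\<^sub>2 + t *\<^sub>R B\<^sub>2) ** ((1 - t) *\<^sub>R A\<^sub>2 + t *\<^sub>R B\<^sub>2)
    - ((1 - t) *\<^sub>R A\<^sub>1 + t *\<^sub>R B\<^sub>1) ** transpose ((1 - t) *\<^sub>R A\<^sub>1 + t *\<^sub>R B\<^sub>1)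
    = (t * (1 - t)) *\<^sub>R (S + transpose S)"
proof -
  \<comment> \<open>Naming 1 - t keeps it a single scalar while the products are expanded.\<close>
  define s where "s = 1 - t"
  show ?thesis
    unfolding s_def[symmetric] S_def
    by (simp add: transpose_add transpose_diff transpose_scalar matrix_transpose_mul
        matrix_add_ldistrib matrix_add_rdistrib matrix_scalar_ac scalar_matrix_assoc[symmetric] A B
        scaleR_add_right scaleR_diff_right mult.commute)
qed

text \<open>At each \<open>p\<close> the dependence of the defect on \<open>t\<close> is confined to
  the scalar t (1 - t), so balance at one interior point already decides balance on the whole
  segment.\<close>

lemma balanced_tuple_line_iff:
  assumes A: "balanced N A" and B: "balanced N B"
  shows "(\<forall>t\<in>{0..1}. balanced N (tuple_line N A B t)) \<longleftrightarrow>
    (\<forall>p\<in>{1..N - 1}. skew_symmetric (transpose (A (p + 1)) ** B (p + 1) - A p ** transpose (B p)))"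
    (is "?bal \<longleftrightarrow> (\<forall>p\<in>_. skew_symmetric (?S p))")
proof -
  have defect: "transpose (tuple_line N A B t (p + 1)) ** tuple_line N A B t (p + 1)
      - tuple_line N A B t p ** transpose (tuple_line N A B t p)
      = (t * (1 - t)) *\<^sub>R (?S p + transpose (?S p))" if p: "p \<in> {1..N - 1}" for p t
  proof -
    from p have "p \<in> {1..N}" "p + 1 \<in> {1..N}"
      by auto
    moreover have "transpose (A (p + 1)) ** A (p + 1) = A p ** transpose (A p)"
      "transpose (B (p + 1)) ** B (p + 1) = B p ** transpose (B p)"
      using A B p by (auto simp: balanced_def)
    ultimately show ?thesis
      using balance_defect_line[of "A (p + 1)" "A p" "B (p + 1)" "B p" t]
      by (simp add: tuple_line_def)
  qed
  have iff: "balanced N (tuple_line N A B t) \<longleftrightarrow>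
      (\<forall>p\<in>{1..N - 1}. (t * (1 - t)) *\<^sub>R (?S p + transpose (?S p)) = 0)" for t
    unfolding balanced_def
  proof (rule ball_cong[OF refl])
    fix p assume "p \<in> {1..N - 1}"
    from defect[OF this, of t]
    show "transpose (tuple_line N A B t (p + 1)) ** tuple_line N A B t (p + 1)
        = tuple_line N A B t p ** transpose (tuple_line N A B t p)
        \<longleftrightarrow> (t * (1 - t)) *\<^sub>R (?S p + transpose (?S p)) = 0"
      by (metis right_minus_eq)
  qed
  have skew: "skew_symmetric X \<longleftrightarrow> X + transpose X = 0" for X :: "real^'a^'a"
    by (simp add: skew_symmetric_def add_eq_0_iff)
  show ?thesis
  proof
    assume ?bal
    \<comment> \<open>At t = 1/2 the scalar t (1 - t) is 1/4, so it can be cancelled.\<close>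
    then have "balanced N (tuple_line N A B (1/2))"
      by auto
    then show "\<forall>p\<in>{1..N - 1}. skew_symmetric (?S p)"
      unfolding iff skew by auto
  next
    assume "\<forall>p\<in>{1..N - 1}. skew_symmetric (?S p)"
    then show ?bal
      unfolding iff skew by auto
  qed
qed

section \<open>The cross term expressed through the relative rotations\<close>

lemma orthogonal_matrix_invertible: "invertible U" if "orthogonal_matrix U" for U :: "real^'d^'d"
  using that by (auto simp: orthogonal_matrix_def invertible_def)

lemma orthogonal_matrix_cancel:
  fixes U X :: "real^'d^'d"
  assumes "orthogonal_matrix U"
  shows "X ** transpose U ** U = X" "X ** U ** transpose U = X"
  using assms by (simp_all add: orthogonal_matrix_def flip: matrix_mul_assoc)

text \<open>The letters \<open>U\<close> and \<open>V\<close> stand for the factors of the two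
  endpoints at index p, with subscripts 1 and 2 for p - 1 and p + 1. Since \<open>L\<close> and
  \<open>L'\<close> are symmetric, \<open>?S\<close> factors as
  \<open>U ** L ** transpose ?D ** transpose (V ** L')\<close>. Substituting
  \<open>U ** L = V ** L' ** ?K\<close> turns this into the congruence of
  \<open>transpose (?D ** transpose ?K)\<close> by the invertible matrix
  \<open>V ** L'\<close>.\<close>

lemma skew_symmetric_cross_term_iff:
  fixes L L' U U\<^sub>1 U\<^sub>2 V V\<^sub>1 V\<^sub>2 :: "real^'d^'d"
  assumes L: "positive_diagonal L" and L': "positive_diagonal L'" and V: "orthogonal_matrix V"
  shows "skew_symmetric (transpose (U\<^sub>2 ** L ** transpose U) ** (V\<^sub>2 ** L' ** transpose V)
      - (U ** L ** transpose U\<^sub>1) ** transpose (V ** L' ** transpose V\<^sub>1))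
    \<longleftrightarrow> skew_symmetric ((transpose V\<^sub>2 ** U\<^sub>2 - transpose V\<^sub>1 ** U\<^sub>1)
      ** transpose (matrix_inv L' ** (transpose V ** U) ** L))"
    (is "skew_symmetric ?S \<longleftrightarrow> skew_symmetric (?D ** transpose ?K)")
proof -
  note T = positive_diagonal_transpose[OF L] positive_diagonal_transpose[OF L']
  \<comment> \<open>\<open>matrix_inv\<close> is defined by choice, so its defining equation has to
    be drawn from the existence of an inverse.\<close>
  have inv: "L' ** matrix_inv L' = mat 1"
    using positive_diagonal_invertible[OF L'] unfolding invertible_def matrix_inv_def
    by (rule someI2_ex) blast
  have VLK: "V ** L' ** ?K = U ** L"
  proof -
    have "V ** L' ** ?K = V ** (L' ** matrix_inv L') ** transpose V ** U ** L"
      by (simp add: matrix_mul_assoc)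
    also have "\<dots> = U ** L"
      using V by (simp add: inv orthogonal_matrix_def)
    finally show ?thesis .
  qed
  have "?S = U ** L ** transpose ?D ** (L' ** transpose V)"
    by (simp add: T matrix_transpose_mul transpose_diff matrix_diff_ldistrib matrix_diff_rdistrib
        matrix_mul_assoc)
  also have "\<dots> = (V ** L') ** transpose (?D ** transpose ?K) ** transpose (V ** L')"
    unfolding VLK[symmetric] matrix_transpose_mul[of ?D "transpose ?K"]
      matrix_transpose_mul[of V L'] transpose_transpose T(2)
    by (simp only: matrix_mul_assoc)
  finally show ?thesis
    using V L' by (simp add: skew_symmetric_congruence skew_symmetric_transpose invertible_mult
        orthogonal_matrix_invertible positive_diagonal_invertible)
qed

section \<open>Positive definiteness and full rank\<close>

lemma positive_diagonal_inner_pos: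
  fixes L :: "real^'d^'d"
  assumes "positive_diagonal L" and "x \<noteq> 0"
  shows "x \<bullet> (L *v x) > 0"
proof -
  have diag: "(L *v x) $ i = L $ i $ i * x $ i" for i
  proof -
    have "(L *v x) $ i = (\<Sum>j\<in>{i}. L $ i $ j * x $ j)"
      unfolding matrix_vector_mult_def vec_lambda_beta
      by (rule sum.mono_neutral_right) (use assms(1) in \<open>auto simp: positive_diagonal_def\<close>)
    then show ?thesis by simp
  qed
  obtain k where k: "x $ k \<noteq> 0"
    using \<open>x \<noteq> 0\<close> by (auto simp: vec_eq_iff)
  have "0 < (\<Sum>i\<in>UNIV. L $ i $ i * (x $ i)\<^sup>2)"
  proof (rule sum_pos2[of _ k])
    show "0 < L $ k $ k * (x $ k)\<^sup>2"
      using assms(1) k by (simp add: positive_diagonal_def)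
    show "0 \<le> L $ i $ i * (x $ i)\<^sup>2" for i
      using assms(1) by (simp add: positive_diagonal_def less_imp_le)
  qed auto
  then show ?thesis
    by (simp add: inner_vec_def diag power2_eq_square algebra_simps)
qed

text \<open>Moving \<open>U\<close> across the inner product reduces the claim to the diagonal form
  evaluated at \<open>transpose U *v x\<close>, which is nonzero because \<open>U\<close> maps it
  back to \<open>x\<close>.\<close>

lemma orthogonal_conjugate_inner_pos:
  fixes L U :: "real^'d^'d"
  assumes "positive_diagonal L" and U: "orthogonal_matrix U" and "x \<noteq> 0"
  shows "x \<bullet> ((U ** L ** transpose U) *v x) > 0"
proof -
  have "U *v (transpose U *v x) = x"
    using U by (simp only: matrix_vector_mul_assoc orthogonal_matrix_def matrix_vector_mul_lid)
  then have "transpose U *v x \<noteq> 0"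
    using \<open>x \<noteq> 0\<close> by (metis matrix_vector_mult_0_right)
  then have "(transpose U *v x) \<bullet> (L *v (transpose U *v x)) > 0"
    by (rule positive_diagonal_inner_pos[OF assms(1)])
  then show ?thesis
    by (simp add: dot_lmul_matrix matrix_vector_mul_assoc[symmetric])
qed

text \<open>The hypothesis \<open>R\<close> says that the two summands have the same orthogonal
  polar factor \<open>O'\<close>. Pulling it out on the left leaves the convex combination
  \<open>?M\<close> of positive definite matrices, whose kernel is trivial.\<close>

lemma rank_xi_line:
  fixes L L' U V U' V' :: "real^'d^'d"
  assumes L: "positive_diagonal L" and L': "positive_diagonal L'"
    and orth: "orthogonal_matrix U" "orthogonal_matrix V" "orthogonal_matrix U'" "orthogonal_matrix V'"
    and R: "transpose U' ** U = transpose V' ** V"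
    and t: "t \<in> {0..1}"
  shows "rank ((1 - t) *\<^sub>R (U ** L ** transpose V) + t *\<^sub>R (U' ** L' ** transpose V')) = CARD('d)"
proof -
  let ?P = "V ** L ** transpose V" and ?P' = "V' ** L' ** transpose V'"
  let ?M = "(1 - t) *\<^sub>R ?P + t *\<^sub>R ?P'"
  define O' where "O' = U ** transpose V"
  \<comment> \<open>Multiplying \<open>R\<close> by \<open>U'\<close> on the left and by
    \<open>transpose V\<close> on the right cancels one orthogonal pair on each side, leaving
    \<open>U ** transpose V = U' ** transpose V'\<close>.\<close>
  have "U' ** (transpose U' ** U) ** transpose V = U' ** (transpose V' ** V) ** transpose V"
    by (simp add: R)
  then have O': "O' = U' ** transpose V'"
    using orth by (simp add: O'_def matrix_mul_assoc orthogonal_matrix_cancel)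
      (simp add: orthogonal_matrix_def)
  have A: "U ** L ** transpose V = O' ** ?P"
    unfolding O'_def using orth by (simp add: matrix_mul_assoc orthogonal_matrix_cancel)
  have B: "U' ** L' ** transpose V' = O' ** ?P'"
    unfolding O' using orth by (simp add: matrix_mul_assoc orthogonal_matrix_cancel)
  have eq: "(1 - t) *\<^sub>R (U ** L ** transpose V) + t *\<^sub>R (U' ** L' ** transpose V') = O' ** ?M"
    unfolding A B by (simp add: matrix_add_ldistrib matrix_scalar_ac flip: scalar_matrix_assoc)
  have M_pos: "x \<bullet> (?M *v x) > 0" if "x \<noteq> 0" for x
  proof -
    have "x \<bullet> (?M *v x) = (1 - t) * (x \<bullet> (?P *v x)) + t * (x \<bullet> (?P' *v x))"
      by (simp add: matrix_vector_mult_add_rdistrib inner_add_right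
          flip: scaleR_matrix_vector_assoc)
    also have "\<dots> > 0"
      using t orthogonal_conjugate_inner_pos[OF L orth(2) that]
        orthogonal_conjugate_inner_pos[OF L' orth(4) that]
      \<comment> \<open>At t = 0 only the first summand survives, and it is positive. For t > 0 the
        second is positive and the first is at least nonnegative, even at t = 1.\<close>
      by (cases "t = 0") (auto intro: add_nonneg_pos)
    finally show ?thesis .
  qed
  have "x = 0" if "?M *v x = 0" for x
    using M_pos[of x] that by fastforce
  then have "invertible ?M"
    unfolding invertible_left_inverse matrix_left_invertible_ker by blast
  moreover have "invertible O'"
    unfolding O'_def using orth by (simp add: invertible_mult orthogonal_matrix_invertible)
  ultimately have "invertible (O' ** ?M)"
    by (rule invertible_mult[rotated])
  then show ?thesis
    unfolding eq full_rank_injective by (rule inj_matrix_vector_mult)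
qed

theorem lemma2p2:
  fixes N :: nat
    and L L' :: "real^'d^'d"
    and Q Q' R A B :: "nat \<Rightarrow> real^'d^'d"
    and W :: "real \<Rightarrow> nat \<Rightarrow> real^'d^'d"
  assumes "N \<ge> 1"
    and "positive_diagonal L" and "positive_diagonal L'"
    and "\<And>p. p \<le> N \<Longrightarrow> orthogonal_matrix (Q p)"
    and "\<And>p. p \<le> N \<Longrightarrow> orthogonal_matrix (Q' p)"
    and "A = xi N L Q" and "B = xi N L' Q'"
    and "A \<in> balanced_manifold N" and "B \<in> balanced_manifold N"
    and "\<And>p. p \<le> N \<Longrightarrow> R p = transpose (Q' p) ** Q p"
    and "\<And>t. W t = tuple_line N A B t"
  shows "((\<forall>t\<in>{0..1}. balanced N (W t)) \<longleftrightarrow>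
          (\<forall>p\<in>{1..N - 1}.
             skew_symmetric ((R (p + 1) - R (p - 1)) ** transpose (matrix_inv L' ** R p ** L))))
       \<and> ((\<forall>p\<in>{1..N}. R p = R (p - 1)) \<longrightarrow> (\<forall>t\<in>{0..1}. W t \<in> balanced_manifold N))"
proof -
  note L = assms(2) and L' = assms(3) and Q = assms(4) and Q' = assms(5) and R = assms(10)
    and W = assms(11)
  have A: "A p = Q p ** L ** transpose (Q (p - 1))"
    and B: "B p = Q' p ** L' ** transpose (Q' (p - 1))" if "p \<in> {1..N}" for p
    using that by (simp_all add: assms(6,7) xi_def)
  have "(\<forall>t\<in>{0..1}. balanced N (W t)) \<longleftrightarrow>
      (\<forall>p\<in>{1..N - 1}. skew_symmetric (transpose (A (p + 1)) ** B (p + 1) - A p ** transpose (B p)))"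
    unfolding W using assms(8,9)
    by (intro balanced_tuple_line_iff) (auto simp: balanced_manifold_def)
  also have "\<dots> \<longleftrightarrow> (\<forall>p\<in>{1..N - 1}.
      skew_symmetric ((R (p + 1) - R (p - 1)) ** transpose (matrix_inv L' ** R p ** L)))"
  proof (rule ball_cong[OF refl])
    fix p assume "p \<in> {1..N - 1}"
    \<comment> \<open>Here p is at least 1, so the truncated subtraction in \<open>p - 1\<close> is
      genuine, and all three indices lie where \<open>Q\<close>, \<open>Q'\<close> and
      \<open>R\<close> are constrained.\<close>
    then have p: "p \<in> {1..N}" "p + 1 \<in> {1..N}" "p \<le> N" "p + 1 \<le> N" "p - 1 \<le> N"
      by auto
    show "skew_symmetric (transpose (A (p + 1)) ** B (p + 1) - A p ** transpose (B p)) \<longleftrightarrow>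
        skew_symmetric ((R (p + 1) - R (p - 1)) ** transpose (matrix_inv L' ** R p ** L))"
      using skew_symmetric_cross_term_iff[OF L L' Q'[OF p(3)], of "Q (p + 1)" "Q p" "Q' (p + 1)"
          "Q (p - 1)" "Q' (p - 1)"]
      by (simp only: A[OF p(1)] A[OF p(2)] B[OF p(1)] B[OF p(2)] R[OF p(3)] R[OF p(4)] R[OF p(5)]
          add_diff_cancel_right')
  qed
  finally have bal: "(\<forall>t\<in>{0..1}. balanced N (W t)) \<longleftrightarrow> (\<forall>p\<in>{1..N - 1}.
      skew_symmetric ((R (p + 1) - R (p - 1)) ** transpose (matrix_inv L' ** R p ** L)))" .
  have "W t \<in> balanced_manifold N" if eq: "\<forall>p\<in>{1..N}. R p = R (p - 1)" and t: "t \<in> {0..1}" for t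
  proof -
    \<comment> \<open>The hypothesis at p and at p + 1 collapses the difference. The matrix in the
      criterion is then zero, hence skew symmetric, and the first claim gives balance.\<close>
    have "R (p + 1) - R (p - 1) = 0" if "p \<in> {1..N - 1}" for p
    proof -
      from that have "p \<in> {1..N}" "p + 1 \<in> {1..N}"
        by auto
      with eq have "R p = R (p - 1)" "R (p + 1) = R (p + 1 - 1)"
        by blast+
      then show ?thesis by simp
    qed
    then have "balanced N (W t)"
      using bal t by (simp add: skew_symmetric_def transpose_def vec_eq_iff matrix_matrix_mult_def)
    moreover have "rank (W t p) = CARD('d)" if p: "p \<in> {1..N}" for p
    proof -
      have le: "p \<le> N" "p - 1 \<le> N"
        using p by auto
      \<comment> \<open>This is the equality of \<open>R p\<close> and \<open>R (p - 1)\<close>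
        unfolded, the form in which it yields the common polar factor.\<close>
      have "transpose (Q' p) ** Q p = transpose (Q' (p - 1)) ** Q (p - 1)"
        using eq p unfolding R[OF le(1), symmetric] R[OF le(2), symmetric] by blast
      from rank_xi_line[OF L L' Q[OF le(1)] Q[OF le(2)] Q'[OF le(1)] Q'[OF le(2)] this t]
      show ?thesis
        using p by (simp add: W tuple_line_def A[OF p] B[OF p])
    qed
    \<comment> \<open>The restricted lambda in \<open>tuple_line\<close> makes the combination
      \<open>undefined\<close> off \<open>{1..N}\<close>, as membership in the extensional function
      space demands.\<close>
    moreover have "W t \<in> matrix_tuples N"
      by (simp add: W matrix_tuples_def tuple_line_def)
    ultimately show ?thesis
      by (simp add: balanced_manifold_def)
  qed
  with bal show ?thesis
    by blast
qed

end
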